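(* Every surjective morphism $f\colon X\to Y$ in the category of racks is ${}_rF_q$-central.
   Context: A rack is a set $X$ with two binary operations $\triangleleft,\triangleleft^{-1}$ such that $(x\triangleleft y)\triangleleft^{-1}y = x = (x\triangleleft^{-1}y)\triangleleft y$ and $(x\triangleleft y)\triangleleft z=(x\triangleleft z)\triangleleft(y\triangleleft z)$; a quandle is a rack with $x\triangleleft x=x$. ${}_rF_q\colon\mathsf{Rck}\to\mathsf{Qnd}$ denotes the left adjoint of the inclusion of quandles into racks and ${}^r\eta^q_X\colon X\to{}_rF_q(X)$ the unit. A surjective morphism of racks $t\colon X\to Y$ is ${}_rF_q$-trivial if the square ${}^r\eta^q_Y\circ t={}_rF_q(t)\circ{}^r\eta^q_X$ is a pullback. A surjective morphism of racks $f\colon X\to Y$ is ${}_rF_q$-central if there is a surjective morphism of racks $e\colon E\to Y$ such that the pullback $E\times_YX\to E$ of $f$ along $e$ is ${}_rF_q$-trivial. *)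

theory Defs
  imports "HOL-Algebra.Congruence"
begin

section \<open>Racks and quandles\<close>

record 'a rack = "'a partial_object" +
  tri :: "'a \<Rightarrow> 'a \<Rightarrow> 'a"  (infixl \<open>\<triangleleft>\<index>\<close> 70)
  tri_inv :: "'a \<Rightarrow> 'a \<Rightarrow> 'a"  (infixl \<open>\<triangleleft>\<inverse>\<index>\<close> 70)

locale rack =
  fixes X (structure)
  assumes tri_closed: "\<lbrakk>x \<in> carrier X; y \<in> carrier X\<rbrakk> \<Longrightarrow> x \<triangleleft> y \<in> carrier X"
    and tri_inv_closed: "\<lbrakk>x \<in> carrier X; y \<in> carrier X\<rbrakk> \<Longrightarrow> x \<triangleleft>\<inverse> y \<in> carrier X"
    and tri_tri_inv: "\<lbrakk>x \<in> carrier X; y \<in> carrier X\<rbrakk> \<Longrightarrow> (x \<triangleleft> y) \<triangleleft>\<inverse> y = x"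
    and tri_inv_tri: "\<lbrakk>x \<in> carrier X; y \<in> carrier X\<rbrakk> \<Longrightarrow> (x \<triangleleft>\<inverse> y) \<triangleleft> y = x"
    and tri_distrib: "\<lbrakk>x \<in> carrier X; y \<in> carrier X; z \<in> carrier X\<rbrakk>
      \<Longrightarrow> (x \<triangleleft> y) \<triangleleft> z = (x \<triangleleft> z) \<triangleleft> (y \<triangleleft> z)"

locale quandle = rack +
  assumes tri_idem: "x \<in> carrier X \<Longrightarrow> x \<triangleleft> x = x"

definition rack_hom :: "('a, 'm) rack_scheme \<Rightarrow> ('b, 'n) rack_scheme \<Rightarrow> ('a \<Rightarrow> 'b) set" where
  "rack_hom X Y = {f \<in> carrier X \<rightarrow> carrier Y. \<forall>x \<in> carrier X. \<forall>y \<in> carrier X.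
     f (x \<triangleleft>\<^bsub>X\<^esub> y) = f x \<triangleleft>\<^bsub>Y\<^esub> f y \<and> f (x \<triangleleft>\<inverse>\<^bsub>X\<^esub> y) = f x \<triangleleft>\<inverse>\<^bsub>Y\<^esub> f y}"

definition surjective_rack_hom ::
    "('a, 'm) rack_scheme \<Rightarrow> ('b, 'n) rack_scheme \<Rightarrow> ('a \<Rightarrow> 'b) \<Rightarrow> bool" where
  "surjective_rack_hom X Y f \<longleftrightarrow>
     rack X \<and> rack Y \<and> f \<in> rack_hom X Y \<and> f ` carrier X = carrier Y"

section \<open>Pullbacks of racks\<close>

definition fibre_product ::
    "('a, 'm) rack_scheme \<Rightarrow> ('a \<Rightarrow> 'c) \<Rightarrow> ('b, 'n) rack_scheme \<Rightarrow> ('b \<Rightarrow> 'c) \<Rightarrow> ('a \<times> 'b) rack" where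
  "fibre_product A f B g =
     \<lparr>carrier = {(a, b). a \<in> carrier A \<and> b \<in> carrier B \<and> f a = g b},
      tri = (\<lambda>(a, b) (a', b'). (a \<triangleleft>\<^bsub>A\<^esub> a', b \<triangleleft>\<^bsub>B\<^esub> b')),
      tri_inv = (\<lambda>(a, b) (a', b'). (a \<triangleleft>\<inverse>\<^bsub>A\<^esub> a', b \<triangleleft>\<inverse>\<^bsub>B\<^esub> b'))\<rparr>"

text \<open>
  The square with sides \<open>p : P \<rightarrow> A\<close>, \<open>q : P \<rightarrow> B\<close>, \<open>f : A \<rightarrow> C\<close>, \<open>g : B \<rightarrow> C\<close> is a pullback
  if it commutes and the comparison morphism from \<open>P\<close> to the fibre product is an isomorphism,
  which for racks means a bijective morphism. The lemma \<open>pullback_square_universal\<close> below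
  gives the universal property, for cones with a vertex in an arbitrary type.
\<close>

definition pullback_square ::
    "('p, 'k) rack_scheme \<Rightarrow> ('p \<Rightarrow> 'a) \<Rightarrow> ('p \<Rightarrow> 'b) \<Rightarrow>
     ('a, 'm) rack_scheme \<Rightarrow> ('a \<Rightarrow> 'c) \<Rightarrow> ('b, 'n) rack_scheme \<Rightarrow> ('b \<Rightarrow> 'c) \<Rightarrow>
     ('c, 'l) rack_scheme \<Rightarrow> bool" where
  "pullback_square P p q A f B g C \<longleftrightarrow>
     rack P \<and> rack A \<and> rack B \<and> rack C \<and>
     p \<in> rack_hom P A \<and> q \<in> rack_hom P B \<and> f \<in> rack_hom A C \<and> g \<in> rack_hom B C \<and>
     (\<forall>x \<in> carrier P. f (p x) = g (q x)) \<and>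
     bij_betw (\<lambda>x. (p x, q x)) (carrier P) (carrier (fibre_product A f B g))"

lemma rack_fibre_product:
  assumes "rack A" "rack B" "f \<in> rack_hom A C" "g \<in> rack_hom B C"
  shows "rack (fibre_product A f B g)"
proof -
  interpret A: rack A by fact
  interpret B: rack B by fact
  show ?thesis
    using assms(3,4)
    by unfold_locales
      (auto simp: fibre_product_def rack_hom_def A.tri_closed A.tri_inv_closed A.tri_tri_inv
        A.tri_inv_tri B.tri_closed B.tri_inv_closed B.tri_tri_inv B.tri_inv_tri
        intro: A.tri_distrib B.tri_distrib)
qed

lemma pullback_square_universal:
  assumes sq: "pullback_square P p q A f B g C"
    and W: "rack W" "u \<in> rack_hom W A" "v \<in> rack_hom W B"
      "\<And>w. w \<in> carrier W \<Longrightarrow> f (u w) = g (v w)"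
  shows "\<exists>!h. h \<in> rack_hom W P \<and> h \<in> extensional (carrier W) \<and>
           (\<forall>w \<in> carrier W. p (h w) = u w \<and> q (h w) = v w)"
proof -
  let ?c = "\<lambda>x. (p x, q x)"
  interpret P: rack P using sq by (simp add: pullback_square_def)
  interpret W: rack W by fact
  have bij: "bij_betw ?c (carrier P) (carrier (fibre_product A f B g))"
    and p: "p \<in> rack_hom P A" and q: "q \<in> rack_hom P B"
    using sq by (auto simp: pullback_square_def)
  have inj: "x = y" if "x \<in> carrier P" "y \<in> carrier P" "p x = p y" "q x = q y" for x y
    using bij that by (auto simp: bij_betw_def inj_on_def)
  define h where "h = restrict (\<lambda>w. inv_into (carrier P) ?c (u w, v w)) (carrier W)"
  have uv: "(u w, v w) \<in> ?c ` carrier P" if "w \<in> carrier W" for w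
    using bij W that by (auto simp: bij_betw_def fibre_product_def rack_hom_def)
  have h: "h w \<in> carrier P \<and> p (h w) = u w \<and> q (h w) = v w" if "w \<in> carrier W" for w
    using inv_into_into[OF uv[OF that]] f_inv_into_f[OF uv[OF that]] that by (simp add: h_def)
  have "h \<in> rack_hom W P"
    unfolding rack_hom_def
    using h p q W(2,3)
    by (auto intro!: inj simp: W.tri_closed W.tri_inv_closed P.tri_closed P.tri_inv_closed
        rack_hom_def)
  moreover have "h \<in> extensional (carrier W)" by (simp add: h_def)
  moreover have "k = h" if "k \<in> rack_hom W P \<and> k \<in> extensional (carrier W) \<and>
      (\<forall>w \<in> carrier W. p (k w) = u w \<and> q (k w) = v w)" for k
  proof (rule extensionalityI[of _ "carrier W"])
    fix w assume "w \<in> carrier W"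
    then show "k w = h w" using that h by (intro inj) (auto simp: rack_hom_def)
  qed (use that in \<open>auto simp: h_def\<close>)
  ultimately show ?thesis using h by blast
qed

section \<open>The quandle reflection of a rack\<close>

definition rack_congruence :: "('a, 'm) rack_scheme \<Rightarrow> ('a \<times> 'a) set \<Rightarrow> bool" where
  "rack_congruence X R \<longleftrightarrow> equiv (carrier X) R \<and>
     (\<forall>(x, x') \<in> R. \<forall>(y, y') \<in> R.
        (x \<triangleleft>\<^bsub>X\<^esub> y, x' \<triangleleft>\<^bsub>X\<^esub> y') \<in> R \<and> (x \<triangleleft>\<inverse>\<^bsub>X\<^esub> y, x' \<triangleleft>\<inverse>\<^bsub>X\<^esub> y') \<in> R)"

definition rack_quotient :: "('a, 'm) rack_scheme \<Rightarrow> ('a \<times> 'a) set \<Rightarrow> 'a set rack" where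
  "rack_quotient X R =
     \<lparr>carrier = carrier X // R,
      tri = (\<lambda>A B. \<Union>a \<in> A. \<Union>b \<in> B. R `` {a \<triangleleft>\<^bsub>X\<^esub> b}),
      tri_inv = (\<lambda>A B. \<Union>a \<in> A. \<Union>b \<in> B. R `` {a \<triangleleft>\<inverse>\<^bsub>X\<^esub> b})\<rparr>"

text \<open>
  The left adjoint sends \<open>X\<close> to its quotient by the smallest congruence that relates \<open>x \<triangleleft> x\<close>
  to \<open>x\<close> for every \<open>x\<close>, and the unit is the quotient map. That this is left adjoint to the
  inclusion of quandles into racks is \<open>quandle_rFq\<close> together with \<open>rFq_universal\<close>.
\<close>

definition quandle_congruence :: "('a, 'm) rack_scheme \<Rightarrow> ('a \<times> 'a) set" where
  "quandle_congruence X = \<Inter> {R. rack_congruence X R \<and> (\<forall>x \<in> carrier X. (x \<triangleleft>\<^bsub>X\<^esub> x, x) \<in> R)}"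

definition rFq :: "('a, 'm) rack_scheme \<Rightarrow> 'a set rack" where
  "rFq X = rack_quotient X (quandle_congruence X)"

definition rFq_unit :: "('a, 'm) rack_scheme \<Rightarrow> 'a \<Rightarrow> 'a set" where
  "rFq_unit X x = quandle_congruence X `` {x}"

text \<open>
  The action on morphisms, determined by naturality of the unit; see \<open>rFq_map\<close>.
\<close>

definition rFq_map ::
    "('a, 'm) rack_scheme \<Rightarrow> ('b, 'n) rack_scheme \<Rightarrow> ('a \<Rightarrow> 'b) \<Rightarrow> 'a set \<Rightarrow> 'b set" where
  "rFq_map X Y t = (THE h. h \<in> rack_hom (rFq X) (rFq Y) \<and> h \<in> extensional (carrier (rFq X)) \<and>
     (\<forall>x \<in> carrier X. h (rFq_unit X x) = rFq_unit Y (t x)))"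

context rack
begin

lemma rack_congruence_total: "rack_congruence X (carrier X \<times> carrier X)"
  by (auto simp: rack_congruence_def tri_closed tri_inv_closed
      intro!: equivI refl_onI symI transI)

lemma rack_congruence_quandle_congruence: "rack_congruence X (quandle_congruence X)"
proof -
  let ?\<R> = "{R. rack_congruence X R \<and> (\<forall>x \<in> carrier X. (x \<triangleleft> x, x) \<in> R)}"
  have ne: "carrier X \<times> carrier X \<in> ?\<R>"
    using rack_congruence_total by (auto simp: tri_closed)
  have eq: "equiv (carrier X) R" if "R \<in> ?\<R>" for R
    using that by (simp add: rack_congruence_def)
  have "equiv (carrier X) (\<Inter> ?\<R>)"
  proof (rule equivI)
    show "\<Inter> ?\<R> \<subseteq> carrier X \<times> carrier X" using ne by blast
    show "refl_on (carrier X) (\<Inter> ?\<R>)"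
      using eq by (auto simp: refl_on_def equiv_def)
    show "sym (\<Inter> ?\<R>)"
      using eq by (auto intro!: symI dest: symD simp: equiv_def)
    show "trans (\<Inter> ?\<R>)"
      by (rule transI) (use eq in \<open>unfold equiv_def, blast dest: transD\<close>)
  qed
  moreover have "(x \<triangleleft> y, x' \<triangleleft> y') \<in> R \<and> (x \<triangleleft>\<inverse> y, x' \<triangleleft>\<inverse> y') \<in> R"
    if "R \<in> ?\<R>" "(x, x') \<in> \<Inter> ?\<R>" "(y, y') \<in> \<Inter> ?\<R>" for R x x' y y'
  proof -
    have "rack_congruence X R" "(x, x') \<in> R" "(y, y') \<in> R" using that by blast+
    then show ?thesis unfolding rack_congruence_def by blast
  qed
  ultimately have "rack_congruence X (\<Inter> ?\<R>)"
    unfolding rack_congruence_def[of X "\<Inter> ?\<R>"] by blast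
  then show ?thesis by (simp only: quandle_congruence_def)
qed

lemma equiv_quandle_congruence: "equiv (carrier X) (quandle_congruence X)"
  using rack_congruence_quandle_congruence by (simp add: rack_congruence_def)

lemma carrier_rFq: "carrier (rFq X) = rFq_unit X ` carrier X"
  by (auto simp: rFq_def rack_quotient_def rFq_unit_def quotient_def)

lemma rFq_tri:
  assumes "x \<in> carrier X" "y \<in> carrier X"
  shows "rFq_unit X x \<triangleleft>\<^bsub>rFq X\<^esub> rFq_unit X y = rFq_unit X (x \<triangleleft> y)"
proof -
  have "(\<lambda>a b. quandle_congruence X `` {a \<triangleleft> b}) respects2 quandle_congruence X"
    using rack_congruence_quandle_congruence equiv_class_eq[OF equiv_quandle_congruence]
    by (intro congruent2I') (fastforce simp: rack_congruence_def)
  from UN_equiv_class2[OF equiv_quandle_congruence equiv_quandle_congruence this assms]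
  show ?thesis by (simp add: rFq_def rack_quotient_def rFq_unit_def)
qed

lemma rFq_tri_inv:
  assumes "x \<in> carrier X" "y \<in> carrier X"
  shows "rFq_unit X x \<triangleleft>\<inverse>\<^bsub>rFq X\<^esub> rFq_unit X y = rFq_unit X (x \<triangleleft>\<inverse> y)"
proof -
  have "(\<lambda>a b. quandle_congruence X `` {a \<triangleleft>\<inverse> b}) respects2 quandle_congruence X"
    using rack_congruence_quandle_congruence equiv_class_eq[OF equiv_quandle_congruence]
    by (intro congruent2I') (fastforce simp: rack_congruence_def)
  from UN_equiv_class2[OF equiv_quandle_congruence equiv_quandle_congruence this assms]
  show ?thesis by (simp add: rFq_def rack_quotient_def rFq_unit_def)
qed

lemma quandle_rFq: "quandle (rFq X)"
proof
  have "rFq_unit X (x \<triangleleft> x) = rFq_unit X x" if "x \<in> carrier X" for x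
    unfolding rFq_unit_def
    by (rule equiv_class_eq[OF equiv_quandle_congruence])
      (use that in \<open>auto simp: quandle_congruence_def\<close>)
  then show "\<And>x. x \<in> carrier (rFq X) \<Longrightarrow> x \<triangleleft>\<^bsub>rFq X\<^esub> x = x"
    by (auto simp: carrier_rFq rFq_tri)
qed (auto simp: carrier_rFq rFq_tri rFq_tri_inv tri_closed tri_inv_closed tri_tri_inv tri_inv_tri
    tri_distrib[symmetric])

lemma rFq_unit_hom: "rFq_unit X \<in> rack_hom X (rFq X)"
  by (auto simp: rack_hom_def carrier_rFq rFq_tri rFq_tri_inv)

theorem rFq_universal:
  assumes Q: "quandle Q" and g: "g \<in> rack_hom X Q"
  shows "\<exists>!h. h \<in> rack_hom (rFq X) Q \<and> h \<in> extensional (carrier (rFq X)) \<and>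
           (\<forall>x \<in> carrier X. h (rFq_unit X x) = g x)"
proof -
  interpret Q: quandle Q by fact
  let ?K = "{(x, y). x \<in> carrier X \<and> y \<in> carrier X \<and> g x = g y}"
  have gc: "g x \<in> carrier Q" if "x \<in> carrier X" for x
    using g that by (auto simp: rack_hom_def)
  have "rack_congruence X ?K"
    using g unfolding rack_congruence_def
    by (auto intro!: equivI refl_onI symI transI simp: rack_hom_def tri_closed tri_inv_closed)
  moreover have "\<forall>x \<in> carrier X. (x \<triangleleft> x, x) \<in> ?K"
    using g gc by (auto simp: rack_hom_def tri_closed Q.tri_idem)
  ultimately have K: "quandle_congruence X \<subseteq> ?K"
    by (auto simp: quandle_congruence_def)
  define h where "h = restrict (\<lambda>c. g (SOME x. x \<in> carrier X \<and> rFq_unit X x = c)) (carrier (rFq X))"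
  have h: "h (rFq_unit X x) = g x" if x: "x \<in> carrier X" for x
  proof -
    let ?y = "SOME y. y \<in> carrier X \<and> rFq_unit X y = rFq_unit X x"
    have y: "?y \<in> carrier X \<and> rFq_unit X ?y = rFq_unit X x"
      by (rule someI[of _ x]) (simp add: x)
    then have "(?y, x) \<in> quandle_congruence X"
      using eq_equiv_class_iff[OF equiv_quandle_congruence, of ?y x] x
      by (simp add: rFq_unit_def)
    with K have "g ?y = g x" by blast
    with x show ?thesis by (simp add: h_def carrier_rFq)
  qed
  have "h \<in> rack_hom (rFq X) Q"
    using g by (auto simp: rack_hom_def carrier_rFq rFq_tri rFq_tri_inv h tri_closed tri_inv_closed)
  moreover have ext: "h \<in> extensional (carrier (rFq X))" by (simp add: h_def)
  moreover have "k = h" if "k \<in> rack_hom (rFq X) Q \<and> k \<in> extensional (carrier (rFq X)) \<and>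
      (\<forall>x \<in> carrier X. k (rFq_unit X x) = g x)" for k
    by (rule extensionalityI[of _ "carrier (rFq X)"])
      (use that h ext in \<open>auto simp: carrier_rFq\<close>)
  ultimately show ?thesis using h by blast
qed

end

lemma rFq_map:
  assumes X: "rack X" and Y: "rack Y" and t: "t \<in> rack_hom X Y"
  shows "rFq_map X Y t \<in> rack_hom (rFq X) (rFq Y)"
    and "x \<in> carrier X \<Longrightarrow> rFq_map X Y t (rFq_unit X x) = rFq_unit Y (t x)"
proof -
  interpret X: rack X by fact
  interpret Y: rack Y by fact
  have "(\<lambda>x. rFq_unit Y (t x)) \<in> rack_hom X (rFq Y)"
    using t Y.rFq_unit_hom by (auto simp: rack_hom_def Pi_iff)
  from theI'[OF X.rFq_universal[OF Y.quandle_rFq this]]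
  show "rFq_map X Y t \<in> rack_hom (rFq X) (rFq Y)"
    and "x \<in> carrier X \<Longrightarrow> rFq_map X Y t (rFq_unit X x) = rFq_unit Y (t x)"
    by (auto simp: rFq_map_def)
qed

section \<open>Trivial and central morphisms\<close>

definition rFq_trivial ::
    "('a, 'm) rack_scheme \<Rightarrow> ('b, 'n) rack_scheme \<Rightarrow> ('a \<Rightarrow> 'b) \<Rightarrow> bool" where
  "rFq_trivial X Y t \<longleftrightarrow> surjective_rack_hom X Y t \<and>
     pullback_square X t (rFq_unit X) Y (rFq_unit Y) (rFq X) (rFq_map X Y t) (rFq Y)"

text \<open>
  HOL cannot quantify over types inside a formula, so the type \<open>'e\<close> in which the covering
  rack \<open>E\<close> has its carrier is a parameter of centrality. Centrality for some \<open>'e\<close> implies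
  centrality in the sense that allows every rack \<open>E\<close>.
\<close>

definition rFq_central ::
    "'e itself \<Rightarrow> ('a, 'm) rack_scheme \<Rightarrow> ('b, 'n) rack_scheme \<Rightarrow> ('a \<Rightarrow> 'b) \<Rightarrow> bool" where
  "rFq_central TYPE('e) X Y f \<longleftrightarrow> surjective_rack_hom X Y f \<and>
     (\<exists>(E :: 'e rack) e. surjective_rack_hom E Y e \<and>
        rFq_trivial (fibre_product E e X f) E fst)"

text \<open>
  The elements of the free rack on a set \<open>B\<close> are pairs of an element of \<open>B\<close> and an element of
  the free group on \<open>B\<close>, which a reduced word with signed letters represents. The free rack on
  \<open>carrier Y\<close> maps to \<open>Y\<close> through every surjective morphism onto \<open>Y\<close>, so its type is large
  enough for the covering racks of \<open>Y\<close>.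
\<close>

type_synonym 'b free_rack_elem = "'b \<times> (bool \<times> 'b) list"

end

theory Submission
  imports Defs
begin

text \<open>
  Every rack carries the kink map \<open>\<pi> x = x \<triangleleft> x\<close>, which is a bijection compatible with both
  operations, in the sense that \<open>\<pi> x \<triangleleft> y = \<pi> (x \<triangleleft> y)\<close> and \<open>x \<triangleleft> \<pi> y = x \<triangleleft> y\<close>. Hence lying in
  the same orbit of \<open>\<pi>\<close> is a congruence, and the quandle reflection of a rack is its set of
  \<open>\<pi>\<close>-orbits (\<open>rFq_unit_eq_iff\<close>).

  Consequently a surjective morphism \<open>t : X \<rightarrow> Y\<close> is trivial as soon as \<open>\<pi>\<close> acts freely on \<open>Y\<close>
  (\<open>rFq_trivial_if_kink_free\<close>). Over a point \<open>y\<close> and an orbit of \<open>X\<close> that lies over the orbit of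
  \<open>y\<close> there is always a point of \<open>X\<close>: move along the orbit until the image is \<open>y\<close>. Two such
  points differ by a power of \<open>\<pi>\<close> that fixes \<open>y\<close>, which by freeness is the identity.

  A trivial pullback therefore only asks for a surjection \<open>E \<rightarrow> Y\<close> from a rack with free kink
  map. The rack \<open>Y \<times> \<int>\<close> with \<open>(y, i) \<triangleleft> (z, j) = (y \<triangleleft> z, i + 1)\<close> is one, because its kink map
  increases the second coordinate (\<open>rack_counter_rack\<close>, \<open>kink_free_counter_rack\<close>). It is the
  product of \<open>Y\<close> with the free rack on one generator. An integer \<open>i\<close> is represented by the
  reduced word of the \<open>i\<close>-th power of one fixed letter.
\<close>

section \<open>The kink map\<close>

definition kink :: "('a, 'm) rack_scheme \<Rightarrow> 'a \<Rightarrow> 'a" where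
  "kink X x = x \<triangleleft>\<^bsub>X\<^esub> x"

definition kink_free :: "('a, 'm) rack_scheme \<Rightarrow> bool" where
  "kink_free X \<longleftrightarrow>
     (\<forall>x \<in> carrier X. \<forall>m n. (kink X ^^ m) x = (kink X ^^ n) x \<longrightarrow> m = n)"

text \<open>
  Membership in the same orbit of the kink map, phrased with two forward iterates so that no
  negative powers occur.
\<close>

definition kink_orbit_rel :: "('a, 'm) rack_scheme \<Rightarrow> ('a \<times> 'a) set" where
  "kink_orbit_rel X =
     {(x, y) \<in> carrier X \<times> carrier X. \<exists>m n. (kink X ^^ m) x = (kink X ^^ n) y}"

context rack
begin

lemma kink_closed: "x \<in> carrier X \<Longrightarrow> kink X x \<in> carrier X"
  by (simp add: kink_def tri_closed)

lemma kink_pow_closed: "x \<in> carrier X \<Longrightarrow> (kink X ^^ n) x \<in> carrier X"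
  by (induction n) (simp_all add: kink_closed)

lemma tri_cancel:
  assumes "x \<in> carrier X" "y \<in> carrier X" "z \<in> carrier X" "x \<triangleleft> z = y \<triangleleft> z"
  shows "x = y"
  using assms tri_tri_inv by metis

lemma kink_tri:
  "\<lbrakk>x \<in> carrier X; y \<in> carrier X\<rbrakk> \<Longrightarrow> kink X x \<triangleleft> y = kink X (x \<triangleleft> y)"
  by (simp add: kink_def tri_distrib)

lemma kink_tri_inv:
  assumes "x \<in> carrier X" "y \<in> carrier X"
  shows "kink X x \<triangleleft>\<inverse> y = kink X (x \<triangleleft>\<inverse> y)"
  by (rule tri_cancel[of _ _ y])
    (use assms in \<open>simp_all add: kink_tri tri_inv_tri kink_closed tri_inv_closed\<close>)

text \<open>
  Every \<open>x\<close> has the form \<open>u \<triangleleft> y\<close>, and \<open>(u \<triangleleft> y) \<triangleleft> y = (u \<triangleleft> y) \<triangleleft> (y \<triangleleft> y)\<close> is an instance of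
  self-distributivity.
\<close>

lemma tri_kink:
  assumes "x \<in> carrier X" "y \<in> carrier X"
  shows "x \<triangleleft> kink X y = x \<triangleleft> y"
proof -
  have "((x \<triangleleft>\<inverse> y) \<triangleleft> y) \<triangleleft> y = ((x \<triangleleft>\<inverse> y) \<triangleleft> y) \<triangleleft> (y \<triangleleft> y)"
    using assms by (intro tri_distrib) (simp_all add: tri_inv_closed)
  then show ?thesis by (simp only: kink_def tri_inv_tri[OF assms])
qed

lemma tri_inv_kink:
  assumes "x \<in> carrier X" "y \<in> carrier X"
  shows "x \<triangleleft>\<inverse> kink X y = x \<triangleleft>\<inverse> y"
proof (rule tri_cancel[of _ _ y])
  have "(x \<triangleleft>\<inverse> kink X y) \<triangleleft> y = (x \<triangleleft>\<inverse> kink X y) \<triangleleft> kink X y"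
    using assms by (simp add: tri_kink tri_inv_closed kink_closed)
  then show "(x \<triangleleft>\<inverse> kink X y) \<triangleleft> y = (x \<triangleleft>\<inverse> y) \<triangleleft> y"
    using assms by (simp add: tri_inv_tri kink_closed)
qed (use assms in \<open>simp_all add: tri_inv_closed kink_closed\<close>)

lemma kink_tri_inv_self:
  assumes "x \<in> carrier X"
  shows "kink X (x \<triangleleft>\<inverse> x) = x"
proof -
  have "kink X (x \<triangleleft>\<inverse> x) = kink X x \<triangleleft>\<inverse> x" using assms by (simp add: kink_tri_inv)
  also have "\<dots> = x" using assms by (simp add: kink_def[of X x] tri_tri_inv)
  finally show ?thesis .
qed

lemma kink_inj:
  assumes "x \<in> carrier X" "y \<in> carrier X" "kink X x = kink X y"
  shows "x = y"
proof -
  have "kink X z \<triangleleft>\<inverse> kink X z = z" if "z \<in> carrier X" for z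
  proof -
    have "kink X z \<triangleleft>\<inverse> kink X z = kink X z \<triangleleft>\<inverse> z" using that by (simp add: tri_inv_kink kink_closed)
    also have "\<dots> = z" using that by (simp add: kink_def tri_tri_inv)
    finally show ?thesis .
  qed
  then show ?thesis using assms by metis
qed

lemma kink_pow_inj:
  "\<lbrakk>x \<in> carrier X; y \<in> carrier X; (kink X ^^ n) x = (kink X ^^ n) y\<rbrakk> \<Longrightarrow> x = y"
  by (induction n) (auto dest!: kink_inj[rotated 2] simp: kink_pow_closed)

lemma kink_pow_surj:
  "x \<in> carrier X \<Longrightarrow> \<exists>u \<in> carrier X. (kink X ^^ n) u = x"
proof (induction n arbitrary: x)
  case (Suc n)
  then obtain u where "u \<in> carrier X" "(kink X ^^ n) u = x \<triangleleft>\<inverse> x"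
    using tri_inv_closed by blast
  then show ?case using Suc.prems by (auto simp: kink_tri_inv_self intro!: bexI[of _ u])
qed auto

lemma kink_pow_tri:
  "\<lbrakk>x \<in> carrier X; y \<in> carrier X\<rbrakk> \<Longrightarrow> (kink X ^^ m) x \<triangleleft> (kink X ^^ n) y = (kink X ^^ m) (x \<triangleleft> y)"
proof (induction m)
  case 0
  then show ?case by (induction n) (simp_all add: tri_kink kink_pow_closed)
qed (simp add: kink_tri kink_pow_closed)

lemma kink_pow_tri_inv:
  "\<lbrakk>x \<in> carrier X; y \<in> carrier X\<rbrakk> \<Longrightarrow>
    (kink X ^^ m) x \<triangleleft>\<inverse> (kink X ^^ n) y = (kink X ^^ m) (x \<triangleleft>\<inverse> y)"
proof (induction m)
  case 0
  then show ?case by (induction n) (simp_all add: tri_inv_kink kink_pow_closed)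
qed (simp add: kink_tri_inv kink_pow_closed)

section \<open>The quandle reflection as a set of orbits\<close>

lemma rack_congruence_kink_orbit_rel: "rack_congruence X (kink_orbit_rel X)"
proof -
  have "equiv (carrier X) (kink_orbit_rel X)"
  proof (rule equivI)
    show "kink_orbit_rel X \<subseteq> carrier X \<times> carrier X" by (auto simp: kink_orbit_rel_def)
    show "refl_on (carrier X) (kink_orbit_rel X)"
      by (rule refl_onI) (auto simp: kink_orbit_rel_def)
    show "sym (kink_orbit_rel X)" by (rule symI) (auto simp: kink_orbit_rel_def, metis)
    show "trans (kink_orbit_rel X)"
    proof (rule transI)
      fix x y z assume "(x, y) \<in> kink_orbit_rel X" "(y, z) \<in> kink_orbit_rel X"
      then obtain m n k l where xyz: "x \<in> carrier X" "z \<in> carrier X"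
        and e: "(kink X ^^ m) x = (kink X ^^ n) y" "(kink X ^^ k) y = (kink X ^^ l) z"
        by (auto simp: kink_orbit_rel_def)
      have "(kink X ^^ (k + m)) x = (kink X ^^ (k + n)) y" using e by (simp add: funpow_add)
      also have "\<dots> = (kink X ^^ (n + l)) z"
        using e by (simp add: add.commute[of k] funpow_add)
      finally show "(x, z) \<in> kink_orbit_rel X" using xyz by (auto simp: kink_orbit_rel_def)
    qed
  qed
  moreover have "(x \<triangleleft> y, x' \<triangleleft> y') \<in> kink_orbit_rel X \<and> (x \<triangleleft>\<inverse> y, x' \<triangleleft>\<inverse> y') \<in> kink_orbit_rel X"
    if related: "(x, x') \<in> kink_orbit_rel X" "(y, y') \<in> kink_orbit_rel X" for x x' y y'
  proof -
    obtain m n k l where c: "x \<in> carrier X" "x' \<in> carrier X" "y \<in> carrier X" "y' \<in> carrier X"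
      and e: "(kink X ^^ m) x = (kink X ^^ n) x'" "(kink X ^^ k) y = (kink X ^^ l) y'"
      using related by (auto simp: kink_orbit_rel_def)
    have "(kink X ^^ m) (x \<triangleleft> y) = (kink X ^^ n) (x' \<triangleleft> y')"
      using c e kink_pow_tri by metis
    moreover have "(kink X ^^ m) (x \<triangleleft>\<inverse> y) = (kink X ^^ n) (x' \<triangleleft>\<inverse> y')"
      using c e kink_pow_tri_inv by metis
    ultimately show ?thesis using c by (auto simp: kink_orbit_rel_def tri_closed tri_inv_closed)
  qed
  ultimately show ?thesis unfolding rack_congruence_def by blast
qed

lemma rFq_unit_kink_pow:
  assumes "x \<in> carrier X"
  shows "rFq_unit X ((kink X ^^ n) x) = rFq_unit X x"
proof (induction n)
  case (Suc n)
  interpret Q: quandle "rFq X" by (rule quandle_rFq)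
  have c: "(kink X ^^ n) x \<in> carrier X" using assms by (rule kink_pow_closed)
  then have "rFq_unit X (kink X ((kink X ^^ n) x)) = rFq_unit X ((kink X ^^ n) x)"
    by (simp add: kink_def rFq_tri[symmetric] Q.tri_idem carrier_rFq)
  then show ?case using Suc by simp
qed simp

text \<open>
  The smallest congruence defining the reflection is contained in the orbit relation because
  the latter is a congruence identifying \<open>x \<triangleleft> x\<close> with \<open>x\<close>; conversely the kink map becomes the
  identity in any quandle.
\<close>

lemma rFq_unit_eq_iff:
  assumes "x \<in> carrier X" "y \<in> carrier X"
  shows "rFq_unit X x = rFq_unit X y \<longleftrightarrow> (\<exists>m n. (kink X ^^ m) x = (kink X ^^ n) y)"
proof
  assume "rFq_unit X x = rFq_unit X y"
  then have "(x, y) \<in> quandle_congruence X"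
    using eq_equiv_class_iff[OF equiv_quandle_congruence assms] by (simp add: rFq_unit_def)
  moreover have "(z \<triangleleft> z, z) \<in> kink_orbit_rel X" if "z \<in> carrier X" for z
  proof -
    have "(kink X ^^ 0) (z \<triangleleft> z) = (kink X ^^ 1) z" by (simp add: kink_def)
    then show ?thesis using that unfolding kink_orbit_rel_def by (blast intro: tri_closed)
  qed
  ultimately have "(x, y) \<in> kink_orbit_rel X"
    using rack_congruence_kink_orbit_rel unfolding quandle_congruence_def by blast
  then show "\<exists>m n. (kink X ^^ m) x = (kink X ^^ n) y" by (simp add: kink_orbit_rel_def)
next
  assume "\<exists>m n. (kink X ^^ m) x = (kink X ^^ n) y"
  then show "rFq_unit X x = rFq_unit X y" using assms rFq_unit_kink_pow by metis
qed

end

section \<open>Triviality over a rack with free kink map\<close>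

lemma rack_hom_kink_pow:
  assumes "rack X" "t \<in> rack_hom X Y" "x \<in> carrier X"
  shows "t ((kink X ^^ n) x) = (kink Y ^^ n) (t x)"
proof -
  interpret rack X by fact
  show ?thesis
    using assms(2,3) kink_pow_closed[OF assms(3)]
    by (induction n) (simp_all add: rack_hom_def kink_def)
qed

lemma rFq_trivial_if_kink_free:
  assumes t: "surjective_rack_hom X Y t" and free: "kink_free Y"
  shows "rFq_trivial X Y t"
proof -
  interpret X: rack X using t by (simp add: surjective_rack_hom_def)
  interpret Y: rack Y using t by (simp add: surjective_rack_hom_def)
  have hom: "t \<in> rack_hom X Y" and onto: "t ` carrier X = carrier Y"
    using t by (auto simp: surjective_rack_hom_def)
  have tc: "t x \<in> carrier Y" if "x \<in> carrier X" for x using that onto by blast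
  note tpow = rack_hom_kink_pow[OF X.rack_axioms hom]
  note map = rFq_map[OF X.rack_axioms Y.rack_axioms hom]
  let ?c = "\<lambda>x. (t x, rFq_unit X x)"
  let ?P = "fibre_product Y (rFq_unit Y) (rFq X) (rFq_map X Y t)"
  have "inj_on ?c (carrier X)"
  proof (rule inj_onI)
    fix x x' assume x: "x \<in> carrier X" and x': "x' \<in> carrier X" and "?c x = ?c x'"
    then have tt: "t x = t x'" and "rFq_unit X x = rFq_unit X x'" by auto
    then obtain m n where mn: "(kink X ^^ m) x = (kink X ^^ n) x'"
      using X.rFq_unit_eq_iff x x' by blast
    then have "(kink Y ^^ m) (t x) = (kink Y ^^ n) (t x)"
      using tpow[OF x, of m] tpow[OF x', of n] tt by simp
    then have "m = n" using free tc[OF x] unfolding kink_free_def by blast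
    then show "x = x'" using X.kink_pow_inj x x' mn by blast
  qed
  moreover have "?c ` carrier X = carrier ?P"
  proof
    show "?c ` carrier X \<subseteq> carrier ?P"
      by (auto simp: fibre_product_def tc map X.carrier_rFq)
    show "carrier ?P \<subseteq> ?c ` carrier X"
    proof
      fix p assume "p \<in> carrier ?P"
      then obtain y x where p: "p = (y, rFq_unit X x)" and y: "y \<in> carrier Y"
        and x: "x \<in> carrier X" and "rFq_unit Y y = rFq_unit Y (t x)"
        by (auto simp: fibre_product_def X.carrier_rFq map)
      then obtain m n where mn: "(kink Y ^^ n) y = (kink Y ^^ m) (t x)"
        using Y.rFq_unit_eq_iff[OF y tc[OF x]] by blast
      \<comment> \<open>\<open>u\<close> is \<open>x\<close> moved by the power \<open>m - n\<close> of the kink map\<close>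
      obtain u where u: "u \<in> carrier X" "(kink X ^^ n) u = (kink X ^^ m) x"
        using X.kink_pow_surj X.kink_pow_closed[OF x] by blast
      have "(kink Y ^^ n) (t u) = (kink Y ^^ n) y"
        using tpow[OF u(1), of n] tpow[OF x, of m] u(2) mn by simp
      then have "t u = y" using Y.kink_pow_inj tc[OF u(1)] y by blast
      moreover have "rFq_unit X u = rFq_unit X x" using X.rFq_unit_eq_iff u x by blast
      ultimately show "p \<in> ?c ` carrier X" using p u(1) by auto
    qed
  qed
  ultimately have "bij_betw ?c (carrier X) (carrier ?P)" by (simp add: bij_betw_def)
  moreover have "rack (rFq X)" "rack (rFq Y)"
    using X.quandle_rFq Y.quandle_rFq by (simp_all add: quandle_def)
  ultimately show ?thesis
    using t hom map X.rack_axioms Y.rack_axioms X.rFq_unit_hom Y.rFq_unit_hom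
    by (simp add: rFq_trivial_def pullback_square_def)
qed

lemma surjective_fibre_product_fst:
  assumes "rack E" "e \<in> rack_hom E Y" "surjective_rack_hom X Y f"
  shows "surjective_rack_hom (fibre_product E e X f) E fst"
proof -
  have f: "rack X" "f \<in> rack_hom X Y" "f ` carrier X = carrier Y"
    using assms(3) by (auto simp: surjective_rack_hom_def)
  have "a \<in> fst ` carrier (fibre_product E e X f)" if a: "a \<in> carrier E" for a
  proof -
    have "e a \<in> f ` carrier X" using a f(3) assms(2) by (auto simp: rack_hom_def)
    then obtain x where "x \<in> carrier X" "e a = f x" by blast
    then show ?thesis using a by (force simp: fibre_product_def)
  qed
  then show ?thesis
    using rack_fibre_product[OF assms(1) f(1) assms(2) f(2)] assms(1)
    by (auto simp: surjective_rack_hom_def rack_hom_def fibre_product_def)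
qed

section \<open>A covering rack with free kink map\<close>

text \<open>
  The rack \<open>Y \<times> \<int>\<close> in which every action increases the integer by one, transported along an
  injection \<open>c\<close> of \<open>\<int>\<close> into the type that houses the second component.
\<close>

definition counter_rack :: "(int \<Rightarrow> 'c) \<Rightarrow> ('b, 'm) rack_scheme \<Rightarrow> ('b \<times> 'c) rack" where
  "counter_rack c Y =
     \<lparr>carrier = carrier Y \<times> range c,
      tri = (\<lambda>(y, v) (z, w). (y \<triangleleft>\<^bsub>Y\<^esub> z, c (inv c v + 1))),
      tri_inv = (\<lambda>(y, v) (z, w). (y \<triangleleft>\<inverse>\<^bsub>Y\<^esub> z, c (inv c v - 1)))\<rparr>"

lemma rack_counter_rack:
  assumes "rack Y" "inj c"
  shows "rack (counter_rack c Y)"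
proof -
  interpret Y: rack Y by fact
  show ?thesis
    using assms(2)
    by unfold_locales
      (auto simp: counter_rack_def Y.tri_closed Y.tri_inv_closed Y.tri_tri_inv Y.tri_inv_tri
        intro: Y.tri_distrib)
qed

lemma surjective_counter_rack_fst:
  assumes "rack Y" "inj c"
  shows "surjective_rack_hom (counter_rack c Y) Y fst"
  using assms rack_counter_rack[OF assms]
  by (force simp: surjective_rack_hom_def rack_hom_def counter_rack_def)

lemma kink_free_counter_rack:
  assumes "inj c"
  shows "kink_free (counter_rack c Y)"
proof -
  have "snd ((kink (counter_rack c Y) ^^ n) (y, c i)) = c (i + int n)" for y i n
  proof (induction n)
    case (Suc n)
    then show ?case
      using assms by (auto simp: kink_def counter_rack_def split_beta add.commute add.left_commute)
  qed simp
  moreover have "y \<in> carrier (counter_rack c Y) \<Longrightarrow> \<exists>i. y = (fst y, c i)" for y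
    by (auto simp: counter_rack_def)
  ultimately show ?thesis
    unfolding kink_free_def using assms by (metis add_left_cancel injD of_nat_eq_iff)
qed

text \<open>The reduced word of the \<open>i\<close>-th power of a fixed letter; the sign of \<open>i\<close> marks inverses.\<close>

definition power_word :: "int \<Rightarrow> (bool \<times> 'b) list" where
  "power_word i = replicate (nat \<bar>i\<bar>) (i < 0, undefined)"

lemma inj_power_word: "inj power_word"
proof (rule injI)
  fix i j :: int
  assume eq: "(power_word i :: (bool \<times> 'b) list) = power_word j"
  from arg_cong[OF eq, of length] have abs: "\<bar>i\<bar> = \<bar>j\<bar>" by (simp add: power_word_def)
  show "i = j"
  proof (cases "i = 0")
    case False
    then have "(i < 0) = (j < 0)" using eq abs by (auto simp: power_word_def)
    then show ?thesis using abs by auto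
  qed (use abs in simp)
qed

theorem proposition2p5p2p2:
  fixes X :: "'a rack" and Y :: "'b rack" and f :: "'a \<Rightarrow> 'b"
  assumes "rack X" and "rack Y"
    and "f \<in> rack_hom X Y" and "f ` carrier X = carrier Y"
  shows "rFq_central TYPE('b free_rack_elem) X Y f"
proof -
  let ?E = "counter_rack power_word Y :: 'b free_rack_elem rack"
  have f: "surjective_rack_hom X Y f" using assms by (simp add: surjective_rack_hom_def)
  have e: "surjective_rack_hom ?E Y fst"
    using assms(2) inj_power_word by (rule surjective_counter_rack_fst)
  then have "surjective_rack_hom (fibre_product ?E fst X f) ?E fst"
    using f by (intro surjective_fibre_product_fst) (auto simp: surjective_rack_hom_def)
  then have "rFq_trivial (fibre_product ?E fst X f) ?E fst"
    by (rule rFq_trivial_if_kink_free) (rule kink_free_counter_rack[OF inj_power_word])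
  then show ?thesis using f e unfolding rFq_central_def by blast
qed

end
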